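(* Let $(X,S)$ be a nondegenerate symmetric set with $S(x,y)=(g_x(y),f_y(x))$, and let $\pi:G_X\to\mathbb{Z}^X$ be the map defined by $\pi(g)=t$ if $\phi(g)=st$ with $s\in\mathrm{Aut}(X)$, $t\in\mathbb{Z}^X$. Then: (a) $\pi$ is a 1-cocycle of $G_X$ with coefficients in the $G_X$-module $\mathbb{Z}^X$, i.e. $\pi(g_1g_2)=g_2^{-1}\pi(g_1)+\pi(g_2)$ for all $g_1,g_2\in G_X$; (b) $\pi$ is bijective.
   Context: Let $X$ be a nonempty set and $S:X\times X\to X\times X$ a bijection, $S(x,y)=(g_x(y),f_y(x))$. $(X,S)$ is nondegenerate if all maps $f_y,g_x:X\to X$ are bijections; braided if $S^{12}S^{23}S^{12}=S^{23}S^{12}S^{23}$ on $X^3$; involutive if $S^2=\mathrm{id}$; a symmetric set is an involutive braided set. The structure group $G_X$ is the group generated by the elements of $X$ with defining relations $xy=tz$ whenever $S(x,y)=(t,z)$. For a nondegenerate symmetric set, $x\mapsto f_x^{-1}$ extends to a left action of $G_X$ on $X$. $\mathrm{Aut}(X)$ is the group of permutations of $X$; $\mathbb{Z}^X$ is the free abelian group spanned by $X$ (written additively as a module), with generator $t_x$ corresponding to $x\in X$. $M_X=\mathrm{Aut}(X)\ltimes\mathbb{Z}^X$ is the semidirect product: its elements are $st$ with $s\in \mathrm{Aut}(X)$, $t\in\mathbb{Z}^X$, with $s\,t_x=t_{s(x)}\,s$. The assignment $x\mapsto f_x^{-1}t_x$ extends to a group homomorphism $\phi:G_X\to M_X$.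 The left $G_X$-module structure on $\mathbb{Z}^X$ is the one induced by the action $x\mapsto f_x^{-1}$ of $G_X$ on $X$. *)

theory Defs
  imports "HOL-Algebra.Bij" "HOL-Algebra.Free_Abelian_Groups"
begin

section \<open>Set-theoretic solutions of the braid equation\<close>

text \<open>The components of \<open>S (x, y) = (g\<^sub>x y, f\<^sub>y x)\<close>: the subscript is the first explicit argument.\<close>

definition g_map :: "('a \<times> 'a \<Rightarrow> 'a \<times> 'a) \<Rightarrow> 'a \<Rightarrow> 'a \<Rightarrow> 'a"
  where "g_map S x y = fst (S (x, y))"

definition f_map :: "('a \<times> 'a \<Rightarrow> 'a \<times> 'a) \<Rightarrow> 'a \<Rightarrow> 'a \<Rightarrow> 'a"
  where "f_map S y x = snd (S (x, y))"

definition nondegenerate :: "'a set \<Rightarrow> ('a \<times> 'a \<Rightarrow> 'a \<times> 'a) \<Rightarrow> bool"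
  where "nondegenerate X S \<longleftrightarrow>
    (\<forall>x\<in>X. bij_betw (g_map S x) X X) \<and> (\<forall>y\<in>X. bij_betw (f_map S y) X X)"

definition S12 :: "('a \<times> 'a \<Rightarrow> 'a \<times> 'a) \<Rightarrow> 'a \<times> 'a \<times> 'a \<Rightarrow> 'a \<times> 'a \<times> 'a"
  where "S12 S = (\<lambda>(x, y, z). let (a, b) = S (x, y) in (a, b, z))"

definition S23 :: "('a \<times> 'a \<Rightarrow> 'a \<times> 'a) \<Rightarrow> 'a \<times> 'a \<times> 'a \<Rightarrow> 'a \<times> 'a \<times> 'a"
  where "S23 S = (\<lambda>(x, y, z). let (b, c) = S (y, z) in (x, b, c))"

definition braided :: "'a set \<Rightarrow> ('a \<times> 'a \<Rightarrow> 'a \<times> 'a) \<Rightarrow> bool"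
  where "braided X S \<longleftrightarrow>
    (\<forall>p \<in> X \<times> X \<times> X. S12 S (S23 S (S12 S p)) = S23 S (S12 S (S23 S p)))"

definition involutive :: "'a set \<Rightarrow> ('a \<times> 'a \<Rightarrow> 'a \<times> 'a) \<Rightarrow> bool"
  where "involutive X S \<longleftrightarrow> (\<forall>p \<in> X \<times> X. S (S p) = p)"

definition symmetric_set :: "'a set \<Rightarrow> ('a \<times> 'a \<Rightarrow> 'a \<times> 'a) \<Rightarrow> bool"
  where "symmetric_set X S \<longleftrightarrow>
    X \<noteq> {} \<and> bij_betw S (X \<times> X) (X \<times> X) \<and> braided X S \<and> involutive X S"


section \<open>Groups given by generators and relations\<close>

text \<open>A group word is a list of letters; \<open>(x, True)\<close> stands for the generator \<open>x\<close> and
  \<open>(x, False)\<close> for its formal inverse.\<close>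

type_synonym 'a gword = "('a \<times> bool) list"

definition gwords :: "'a set \<Rightarrow> 'a gword set"
  where "gwords X = lists (X \<times> UNIV)"

inductive pres_eq :: "'a set \<Rightarrow> ('a gword \<times> 'a gword) set \<Rightarrow> 'a gword \<Rightarrow> 'a gword \<Rightarrow> bool"
  for X :: "'a set" and R :: "('a gword \<times> 'a gword) set"
where
  pres_refl: "w \<in> gwords X \<Longrightarrow> pres_eq X R w w"
| pres_sym: "pres_eq X R v w \<Longrightarrow> pres_eq X R w v"
| pres_trans: "pres_eq X R u v \<Longrightarrow> pres_eq X R v w \<Longrightarrow> pres_eq X R u w"
| pres_cancel: "u \<in> gwords X \<Longrightarrow> v \<in> gwords X \<Longrightarrow> x \<in> X \<Longrightarrow>
    pres_eq X R (u @ [(x, b), (x, \<not> b)] @ v) (u @ v)"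
| pres_rel: "u \<in> gwords X \<Longrightarrow> v \<in> gwords X \<Longrightarrow> r \<in> gwords X \<Longrightarrow> s \<in> gwords X \<Longrightarrow> (r, s) \<in> R \<Longrightarrow>
    pres_eq X R (u @ r @ v) (u @ s @ v)"

definition pres_class :: "'a set \<Rightarrow> ('a gword \<times> 'a gword) set \<Rightarrow> 'a gword \<Rightarrow> 'a gword set"
  where "pres_class X R w = {v. pres_eq X R w v}"

definition presented_group :: "'a set \<Rightarrow> ('a gword \<times> 'a gword) set \<Rightarrow> 'a gword set monoid"
  where "presented_group X R =
    \<lparr>carrier = pres_class X R ` gwords X,
     mult = (\<lambda>A B. \<Union>u\<in>A. \<Union>v\<in>B. pres_class X R (u @ v)),
     one = pres_class X R []\<rparr>"

text \<open>The homomorphism from the presented group to \<open>H\<close> that extends the assignment \<open>j\<close> on the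
  generators. It is unique when it exists; extensionality fixes its values off the carrier.\<close>

definition presented_hom ::
    "'a set \<Rightarrow> ('a gword \<times> 'a gword) set \<Rightarrow> ('b, 'c) monoid_scheme \<Rightarrow> ('a \<Rightarrow> 'b) \<Rightarrow> 'a gword set \<Rightarrow> 'b"
  where "presented_hom X R H j =
    (THE h. h \<in> hom (presented_group X R) H \<and> h \<in> extensional (carrier (presented_group X R)) \<and>
            (\<forall>x\<in>X. h (pres_class X R [(x, True)]) = j x))"


section \<open>Group modules and 1-cocycles\<close>

definition group_module :: "('g, 'c) monoid_scheme \<Rightarrow> ('m, 'd) monoid_scheme \<Rightarrow> ('g \<Rightarrow> 'm \<Rightarrow> 'm) \<Rightarrow> bool"
  where "group_module G A act \<longleftrightarrow> group G \<and> comm_group A \<and> act \<in> hom G (AutoGroup A)"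

text \<open>The cocycle condition is taken in the form
  \<open>c(g h) = h\<^sup>-\<^sup>1 \<cdot> c(g) + c(h)\<close>; the operation of the module \<open>A\<close> is written
  multiplicatively, as always for monoid records.\<close>

definition one_cocycle ::
    "('g, 'c) monoid_scheme \<Rightarrow> ('m, 'd) monoid_scheme \<Rightarrow> ('g \<Rightarrow> 'm \<Rightarrow> 'm) \<Rightarrow> ('g \<Rightarrow> 'm) \<Rightarrow> bool"
  where "one_cocycle G A act c \<longleftrightarrow>
    group_module G A act \<and> c \<in> carrier G \<rightarrow> carrier A \<and>
    (\<forall>g\<in>carrier G. \<forall>h\<in>carrier G. c (g \<otimes>\<^bsub>G\<^esub> h) = act (inv\<^bsub>G\<^esub> h) (c g) \<otimes>\<^bsub>A\<^esub> c h)"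


section \<open>The structure group and its map to the lattice\<close>

definition structure_rels :: "'a set \<Rightarrow> ('a \<times> 'a \<Rightarrow> 'a \<times> 'a) \<Rightarrow> ('a gword \<times> 'a gword) set"
  where "structure_rels X S =
    {([(x, True), (y, True)], [(t, True), (z, True)]) | x y t z. x \<in> X \<and> y \<in> X \<and> S (x, y) = (t, z)}"

definition structure_group :: "'a set \<Rightarrow> ('a \<times> 'a \<Rightarrow> 'a \<times> 'a) \<Rightarrow> 'a gword set monoid"
  where "structure_group X S = presented_group X (structure_rels X S)"

definition f_inv :: "'a set \<Rightarrow> ('a \<times> 'a \<Rightarrow> 'a \<times> 'a) \<Rightarrow> 'a \<Rightarrow> 'a \<Rightarrow> 'a"
  where "f_inv X S x = restrict (inv_into X (f_map S x)) X"

definition structure_action :: "'a set \<Rightarrow> ('a \<times> 'a \<Rightarrow> 'a \<times> 'a) \<Rightarrow> 'a gword set \<Rightarrow> 'a \<Rightarrow> 'a"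
  where "structure_action X S = presented_hom X (structure_rels X S) (BijGroup X) (f_inv X S)"

text \<open>The lattice \<open>\<int>\<^sup>X\<close> is \<^term>\<open>free_Abelian_group X\<close>, with \<open>t\<^sub>x\<close> being \<^term>\<open>frag_of x\<close>;
  a permutation \<open>s\<close> acts on it by \<open>t\<^sub>x \<mapsto> t\<^bsub>s(x)\<^esub>\<close>, extended linearly.\<close>

definition lattice_perm :: "'a set \<Rightarrow> ('a \<Rightarrow> 'a) \<Rightarrow> ('a \<Rightarrow>\<^sub>0 int) \<Rightarrow> ('a \<Rightarrow>\<^sub>0 int)"
  where "lattice_perm X s =
    restrict (frag_extend (\<lambda>x. frag_of (s x))) (carrier (free_Abelian_group X))"

definition lattice_action ::
    "'a set \<Rightarrow> ('a \<times> 'a \<Rightarrow> 'a \<times> 'a) \<Rightarrow> 'a gword set \<Rightarrow> ('a \<Rightarrow>\<^sub>0 int) \<Rightarrow> ('a \<Rightarrow>\<^sub>0 int)"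
  where "lattice_action X S g = lattice_perm X (structure_action X S g)"

text \<open>The pair \<open>(s, t)\<close> represents the element \<open>s t\<close>, permutation on the left. The relation
  \<open>s t\<^sub>x = t\<^bsub>s(x)\<^esub> s\<close> gives
  \<open>(s\<^sub>1 t\<^sub>1) (s\<^sub>2 t\<^sub>2) = (s\<^sub>1 s\<^sub>2) (s\<^sub>2\<^sup>-\<^sup>1(t\<^sub>1) + t\<^sub>2)\<close>.\<close>

definition M_group :: "'a set \<Rightarrow> (('a \<Rightarrow> 'a) \<times> ('a \<Rightarrow>\<^sub>0 int)) monoid"
  where "M_group X =
    \<lparr>carrier = carrier (BijGroup X) \<times> carrier (free_Abelian_group X),
     mult = (\<lambda>(s1, t1) (s2, t2).
       (s1 \<otimes>\<^bsub>BijGroup X\<^esub> s2,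
        lattice_perm X (inv\<^bsub>BijGroup X\<^esub> s2) t1 \<otimes>\<^bsub>free_Abelian_group X\<^esub> t2)),
     one = (\<one>\<^bsub>BijGroup X\<^esub>, \<one>\<^bsub>free_Abelian_group X\<^esub>)\<rparr>"

definition phi :: "'a set \<Rightarrow> ('a \<times> 'a \<Rightarrow> 'a \<times> 'a) \<Rightarrow> 'a gword set \<Rightarrow> ('a \<Rightarrow> 'a) \<times> ('a \<Rightarrow>\<^sub>0 int)"
  where "phi X S =
    presented_hom X (structure_rels X S) (M_group X) (\<lambda>x. (f_inv X S x, frag_of x))"

definition pi_map :: "'a set \<Rightarrow> ('a \<times> 'a \<Rightarrow> 'a \<times> 'a) \<Rightarrow> 'a gword set \<Rightarrow> ('a \<Rightarrow>\<^sub>0 int)"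
  where "pi_map X S g = snd (phi X S g)"

end

theory Submission
  imports Defs "HOL-Library.Multiset"
begin

text \<open>
  Write \<open>\<rho>\<^sub>x = f\<^sub>x\<^sup>-\<^sup>1\<close> and \<open>a \<cdot> y\<close> for the action of \<open>a \<in> G\<^sub>X\<close> on
  \<open>y \<in> X\<close>. The braid relation says that \<open>x \<mapsto> \<rho>\<^sub>x\<close> respects the defining relations of
  \<open>G\<^sub>X\<close>, and together with involutivity that \<open>x \<mapsto> \<rho>\<^sub>x t\<^sub>x\<close> does; so both extend to
  \<open>G\<^sub>X\<close>. The permutation part of \<open>\<phi>\<close> is the action, because the two agree on generators, and
  the cocycle rule is then the multiplication rule of \<open>M\<^sub>X\<close> read off in the lattice component.

  For bijectivity, the generators of \<open>\<int>\<^sup>X\<close> are lifted to \<open>G\<^sub>X\<close> as the translations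
  \<open>L\<^sub>y(a) = (a \<cdot> y) a\<close>, where the element \<open>a \<cdot> y\<close> of \<open>X\<close> is taken as a generator of
  \<open>G\<^sub>X\<close>. The cocycle rule gives
  \<open>\<pi>(L\<^sub>y(a)) = a\<^sup>-\<^sup>1 t\<^bsub>a\<cdot>y\<^esub> + \<pi>(a) = \<pi>(a) + t\<^sub>y\<close> (\<open>pi_translation\<close>).
  The \<open>L\<^sub>y\<close> commute, since \<open>\<rho>\<^sub>x(y) x = \<rho>\<^sub>y(x) y\<close> is a defining relation of \<open>G\<^sub>X\<close>
  in disguise (\<open>translation_commute\<close>); each is a bijection of \<open>G\<^sub>X\<close>, because for every
  \<open>z\<close> the equation \<open>f\<^sub>x(z) = x\<close> has exactly one solution \<open>x\<close> (\<open>bij_translation\<close>); and they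
  act transitively, since left multiplication by a generator \<open>x\<close> sends \<open>a\<close> to
  \<open>L\<^sub>y(a)\<close> with \<open>y = a\<^sup>-\<^sup>1 \<cdot> x\<close> (\<open>carrier_subset_if_translation_invariant\<close>).
  So \<open>\<int>\<^sup>X\<close> acts transitively on \<open>G\<^sub>X\<close>, and \<open>\<pi>\<close> intertwines this action with the
  regular action of \<open>\<int>\<^sup>X\<close> on itself and sends \<open>1\<close> to \<open>0\<close>. Every \<open>a\<close> is then the
  translate of \<open>1\<close> by \<open>\<pi>(a)\<close>, and \<open>\<pi>\<close> is a bijection
  (\<open>bij_betw_lattice_if_commuting_translations\<close>).
\<close>

section \<open>Groups given by generators and relations\<close>

lemma pres_eq_imp_gwords:
  assumes "pres_eq X R v w"
  shows "v \<in> gwords X" "w \<in> gwords X"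
  using assms by (induction) (auto simp: gwords_def)

lemma gwords_append [simp]: "u @ v \<in> gwords X \<longleftrightarrow> u \<in> gwords X \<and> v \<in> gwords X"
  and gwords_Nil [simp]: "[] \<in> gwords X"
  and gwords_Cons [simp]: "(x, b) # u \<in> gwords X \<longleftrightarrow> x \<in> X \<and> u \<in> gwords X"
  by (auto simp: gwords_def)

text \<open>One of the two halves of the statement that \<open>pres_eq\<close> is a congruence for
  concatenation, so that classes can be multiplied through representatives.\<close>

lemma pres_eq_append_left:
  assumes "pres_eq X R v w" "u \<in> gwords X"
  shows "pres_eq X R (u @ v) (u @ w)"
  using assms(1)
proof induction
  case (pres_refl w)
  then show ?case using assms(2) by (simp add: pres_eq.pres_refl)
next
  case (pres_cancel a v x b)
  then show ?case using pres_eq.pres_cancel[of "u @ a" X v x R b] assms(2) by simp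
next
  case (pres_rel a v r s)
  then show ?case using pres_eq.pres_rel[of "u @ a" X v r s R] assms(2) by simp
qed (blast intro: pres_eq.pres_sym pres_eq.pres_trans)+

lemma pres_eq_append_right:
  assumes "pres_eq X R v w" "u \<in> gwords X"
  shows "pres_eq X R (v @ u) (w @ u)"
  using assms(1)
proof induction
  case (pres_refl w)
  then show ?case using assms(2) by (simp add: pres_eq.pres_refl)
next
  case (pres_cancel a v x b)
  then show ?case using pres_eq.pres_cancel[of a X "v @ u" x R b] assms(2) by simp
next
  case (pres_rel a v r s)
  then show ?case using pres_eq.pres_rel[of a X "v @ u" r s R] assms(2) by simp
qed (blast intro: pres_eq.pres_sym pres_eq.pres_trans)+

lemma pres_class_eq_iff:
  assumes "w \<in> gwords X"
  shows "pres_class X R v = pres_class X R w \<longleftrightarrow> pres_eq X R v w"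
proof
  assume "pres_class X R v = pres_class X R w"
  then show "pres_eq X R v w"
    using pres_eq.pres_refl[OF assms] by (auto simp: pres_class_def)
next
  assume "pres_eq X R v w"
  then show "pres_class X R v = pres_class X R w"
    unfolding pres_class_def by (blast intro: pres_eq.pres_sym pres_eq.pres_trans)
qed

lemma pres_class_in_carrier [simp]:
  "w \<in> gwords X \<Longrightarrow> pres_class X R w \<in> carrier (presented_group X R)"
  by (simp add: presented_group_def)

lemma one_presented_group: "\<one>\<^bsub>presented_group X R\<^esub> = pres_class X R []"
  by (simp add: presented_group_def)

lemma mult_pres_class:
  assumes u: "u \<in> gwords X" and v: "v \<in> gwords X"
  shows "pres_class X R u \<otimes>\<^bsub>presented_group X R\<^esub> pres_class X R v = pres_class X R (u @ v)"
proof -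
  have "pres_class X R (u' @ v') = pres_class X R (u @ v)"
    if "pres_eq X R u u'" "pres_eq X R v v'" for u' v'
  proof -
    have "pres_eq X R (u @ v) (u' @ v')"
      using that u v pres_eq_imp_gwords[OF that(1)]
      by (blast intro: pres_eq.pres_trans pres_eq_append_left pres_eq_append_right)
    then show ?thesis
      using u v by (subst pres_class_eq_iff) (auto intro: pres_eq.pres_sym)
  qed
  then have "(\<Union>u'\<in>pres_class X R u. \<Union>v'\<in>pres_class X R v. pres_class X R (u' @ v')) =
      (\<Union>u'\<in>pres_class X R u. \<Union>v'\<in>pres_class X R v. pres_class X R (u @ v))"
    by (simp add: pres_class_def[of X R u] pres_class_def[of X R v])
  moreover have "pres_class X R u \<noteq> {}" "pres_class X R v \<noteq> {}"
    using pres_eq.pres_refl[OF u] pres_eq.pres_refl[OF v] by (auto simp: pres_class_def)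
  ultimately show ?thesis
    by (simp add: presented_group_def)
qed

lemma presented_group_cases:
  assumes "g \<in> carrier (presented_group X R)"
  obtains w where "w \<in> gwords X" "g = pres_class X R w"
  using assms by (auto simp: presented_group_def)

definition gword_inv :: "'a gword \<Rightarrow> 'a gword"
  where "gword_inv w = rev (map (\<lambda>(x, b). (x, \<not> b)) w)"

lemma gword_inv_in_gwords [simp]: "w \<in> gwords X \<Longrightarrow> gword_inv w \<in> gwords X"
  by (auto simp: gword_inv_def gwords_def)

lemma pres_eq_gword_inv_append:
  "w \<in> gwords X \<Longrightarrow> pres_eq X R (gword_inv w @ w) []"
proof (induction w)
  case Nil
  show ?case by (simp add: gword_inv_def pres_eq.pres_refl)
next
  case (Cons a w)
  obtain x b where a: "a = (x, b)" by (cases a)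
  have "pres_eq X R (gword_inv w @ [(x, \<not> b), (x, \<not> \<not> b)] @ w) (gword_inv w @ w)"
    using Cons.prems a by (intro pres_eq.pres_cancel) auto
  then have "pres_eq X R (gword_inv (a # w) @ a # w) (gword_inv w @ w)"
    by (simp add: gword_inv_def a)
  then show ?case
    using Cons a by (auto intro: pres_eq.pres_trans)
qed

lemma group_presented_group: "group (presented_group X R)"
proof (rule groupI)
  fix g h assume "g \<in> carrier (presented_group X R)" "h \<in> carrier (presented_group X R)"
  then show "g \<otimes>\<^bsub>presented_group X R\<^esub> h \<in> carrier (presented_group X R)"
    by (elim presented_group_cases) (simp add: mult_pres_class)
next
  fix g h k
  assume "g \<in> carrier (presented_group X R)" "h \<in> carrier (presented_group X R)"
    "k \<in> carrier (presented_group X R)"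
  then show "g \<otimes>\<^bsub>presented_group X R\<^esub> h \<otimes>\<^bsub>presented_group X R\<^esub> k =
      g \<otimes>\<^bsub>presented_group X R\<^esub> (h \<otimes>\<^bsub>presented_group X R\<^esub> k)"
    by (elim presented_group_cases) (simp add: mult_pres_class)
next
  fix g assume "g \<in> carrier (presented_group X R)"
  then obtain w where w: "w \<in> gwords X" "g = pres_class X R w" by (rule presented_group_cases)
  show "\<one>\<^bsub>presented_group X R\<^esub> \<otimes>\<^bsub>presented_group X R\<^esub> g = g"
    using w by (simp add: one_presented_group mult_pres_class)
  have "pres_class X R (gword_inv w) \<otimes>\<^bsub>presented_group X R\<^esub> g = \<one>\<^bsub>presented_group X R\<^esub>"
    using w by (simp add: one_presented_group mult_pres_class pres_class_eq_iff
        pres_eq_gword_inv_append)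
  then show "\<exists>h\<in>carrier (presented_group X R). h \<otimes>\<^bsub>presented_group X R\<^esub> g = \<one>\<^bsub>presented_group X R\<^esub>"
    using w by (meson gword_inv_in_gwords pres_class_in_carrier)
qed (simp add: one_presented_group)

lemma inv_pres_class_generator:
  assumes "x \<in> X"
  shows "inv\<^bsub>presented_group X R\<^esub> pres_class X R [(x, True)] = pres_class X R [(x, False)]"
proof (rule group.inv_equality[OF group_presented_group])
  show "pres_class X R [(x, False)] \<otimes>\<^bsub>presented_group X R\<^esub> pres_class X R [(x, True)] =
      \<one>\<^bsub>presented_group X R\<^esub>"
    using assms pres_eq_gword_inv_append[of "[(x, True)]" X R]
    by (simp add: mult_pres_class one_presented_group pres_class_eq_iff gword_inv_def)
qed (use assms in auto)

text \<open>Prepending one letter at a time builds up every word. Inverse letters get a case of their own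
  because an invariant that is preserved by left multiplication with \<open>x\<close> need not be preserved by
  that with \<open>x\<^sup>-\<^sup>1\<close>.\<close>

lemma presented_group_induct [consumes 1, case_names one generator inverse]:
  assumes g: "g \<in> carrier (presented_group X R)"
    and one: "P \<one>\<^bsub>presented_group X R\<^esub>"
    and gen: "\<And>x g. x \<in> X \<Longrightarrow> g \<in> carrier (presented_group X R) \<Longrightarrow> P g \<Longrightarrow>
      P (pres_class X R [(x, True)] \<otimes>\<^bsub>presented_group X R\<^esub> g)"
    and inv: "\<And>x g. x \<in> X \<Longrightarrow> g \<in> carrier (presented_group X R) \<Longrightarrow> P g \<Longrightarrow>
      P (inv\<^bsub>presented_group X R\<^esub> pres_class X R [(x, True)] \<otimes>\<^bsub>presented_group X R\<^esub> g)"
  shows "P g"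
proof -
  have "P (pres_class X R w)" if "w \<in> gwords X" for w
    using that
  proof (induction w)
    case Nil
    then show ?case using one by (simp add: one_presented_group)
  next
    case (Cons a w)
    obtain x b where a: "a = (x, b)" by (cases a)
    have x: "x \<in> X" and w: "w \<in> gwords X" and P: "P (pres_class X R w)"
      using Cons a by simp_all
    show ?case
    proof (cases b)
      case True
      then show ?thesis
        using gen[OF x pres_class_in_carrier[OF w] P] x w by (simp add: a mult_pres_class)
    next
      case False
      then show ?thesis
        using inv[OF x pres_class_in_carrier[OF w] P] x w
        by (simp add: a mult_pres_class inv_pres_class_generator)
    qed
  qed
  moreover obtain w where "w \<in> gwords X" "g = pres_class X R w"
    using g by (rule presented_group_cases)
  ultimately show ?thesis by simp
qed

definition gword_value :: "('b, 'c) monoid_scheme \<Rightarrow> ('a \<Rightarrow> 'b) \<Rightarrow> 'a gword \<Rightarrow> 'b"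
  where "gword_value H j w =
    foldr (\<lambda>(x, b) a. (if b then j x else inv\<^bsub>H\<^esub> j x) \<otimes>\<^bsub>H\<^esub> a) w \<one>\<^bsub>H\<^esub>"

context group
begin

lemma gword_value_Nil [simp]: "gword_value G j [] = \<one>"
  and gword_value_Cons [simp]:
    "gword_value G j ((x, b) # w) = (if b then j x else inv j x) \<otimes> gword_value G j w"
  by (simp_all add: gword_value_def)

lemma gword_value_closed:
  assumes "j \<in> X \<rightarrow> carrier G" "w \<in> gwords X"
  shows "gword_value G j w \<in> carrier G"
  using assms(2)
proof (induction w)
  case (Cons a w)
  then show ?case using assms(1) by (cases a) (auto simp: Pi_iff)
qed simp

lemma gword_value_append:
  assumes j: "j \<in> X \<rightarrow> carrier G" and "u \<in> gwords X" "v \<in> gwords X"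
  shows "gword_value G j (u @ v) = gword_value G j u \<otimes> gword_value G j v"
  using assms(2)
proof (induction u)
  case Nil
  then show ?case using gword_value_closed[OF j] assms(3) by simp
next
  case (Cons a u)
  then show ?case using j gword_value_closed[OF j] assms(3)
    by (cases a) (auto simp: Pi_iff m_assoc)
qed

lemma gword_value_pres_eq:
  assumes j: "j \<in> X \<rightarrow> carrier G"
    and rels: "\<And>r s. (r, s) \<in> R \<Longrightarrow> r \<in> gwords X \<Longrightarrow> s \<in> gwords X \<Longrightarrow>
      gword_value G j r = gword_value G j s"
    and "pres_eq X R v w"
  shows "gword_value G j v = gword_value G j w"
  using assms(3)
proof induction
  case (pres_cancel u v x b)
  then have "j x \<in> carrier G" using j by auto
  then have "(if b then j x else inv j x) \<otimes> ((if \<not> b then j x else inv j x) \<otimes> a) = a"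
    if "a \<in> carrier G" for a
    using that by (simp add: m_assoc[symmetric])
  then have "gword_value G j ([(x, b), (x, \<not> b)] @ v) = gword_value G j v"
    using gword_value_closed[OF j pres_cancel(2)] by simp
  then show ?case
    using pres_cancel by (simp only: gword_value_append[OF j] gwords_append gwords_Cons gwords_Nil)
next
  case (pres_rel u v r s)
  then show ?case
    by (simp add: gword_value_append[OF j] rels)
qed auto

lemma presented_hom_unique:
  assumes h: "h \<in> hom (presented_group X R) G" and k: "k \<in> hom (presented_group X R) G"
    and eq: "\<And>x. x \<in> X \<Longrightarrow> h (pres_class X R [(x, True)]) = k (pres_class X R [(x, True)])"
    and g: "g \<in> carrier (presented_group X R)"
  shows "h g = k g"
proof -
  interpret h: group_hom "presented_group X R" G h
    using h group_presented_group by (simp add: group_hom_def group_hom_axioms_def)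
  interpret k: group_hom "presented_group X R" G k
    using k group_presented_group by (simp add: group_hom_def group_hom_axioms_def)
  show ?thesis
    using g by (induction rule: presented_group_induct) (simp_all add: eq)
qed

text \<open>The universal property of a presentation. The value of a word in \<open>G\<close> is constant on
  classes by \<open>gword_value_pres_eq\<close>, which gives a homomorphism;
  \<open>presented_hom_unique\<close> and extensionality make it the only one, so the definite description in
  \<open>presented_hom\<close> denotes it.\<close>

lemma presented_hom_extends:
  assumes j: "j \<in> X \<rightarrow> carrier G"
    and rels: "\<And>r s. (r, s) \<in> R \<Longrightarrow> r \<in> gwords X \<Longrightarrow> s \<in> gwords X \<Longrightarrow>
      gword_value G j r = gword_value G j s"
  shows "presented_hom X R G j \<in> hom (presented_group X R) G"
    and "x \<in> X \<Longrightarrow> presented_hom X R G j (pres_class X R [(x, True)]) = j x"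
proof -
  define Q where "Q h \<longleftrightarrow> h \<in> hom (presented_group X R) G \<and>
    h \<in> extensional (carrier (presented_group X R)) \<and>
    (\<forall>x\<in>X. h (pres_class X R [(x, True)]) = j x)" for h
  define k where "k = (\<lambda>A \<in> carrier (presented_group X R).
    gword_value G j (SOME w. w \<in> gwords X \<and> A = pres_class X R w))"
  have k: "k (pres_class X R w) = gword_value G j w" if "w \<in> gwords X" for w
  proof -
    define v where "v = (SOME v. v \<in> gwords X \<and> pres_class X R w = pres_class X R v)"
    have "v \<in> gwords X \<and> pres_class X R w = pres_class X R v"
      unfolding v_def by (rule someI) (use that in simp)
    then have "pres_eq X R w v"
      using pres_class_eq_iff[of v X R w] by blast
    with j rels have "gword_value G j w = gword_value G j v"
      by (rule gword_value_pres_eq)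
    then show ?thesis using that by (simp add: k_def v_def)
  qed
  have "Q k"
    unfolding Q_def
  proof (intro conjI ballI homI)
    show "k A \<in> carrier G" if "A \<in> carrier (presented_group X R)" for A
      using that by (elim presented_group_cases) (simp add: k gword_value_closed[OF j])
    show "k (A \<otimes>\<^bsub>presented_group X R\<^esub> B) = k A \<otimes> k B"
      if "A \<in> carrier (presented_group X R)" "B \<in> carrier (presented_group X R)" for A B
      using that
      by (elim presented_group_cases) (simp add: k mult_pres_class gword_value_append[OF j])
    show "k \<in> extensional (carrier (presented_group X R))" by (simp add: k_def)
    show "k (pres_class X R [(x, True)]) = j x" if "x \<in> X" for x
      using that j by (simp add: k Pi_iff)
  qed
  moreover have "h = k" if "Q h" for h
  proof -
    have hk: "h g = k g" if g: "g \<in> carrier (presented_group X R)" for g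
      by (rule presented_hom_unique[OF _ _ _ g]) (use \<open>Q h\<close> \<open>Q k\<close> in \<open>simp_all add: Q_def\<close>)
    show ?thesis
      by (rule extensionalityI[of h "carrier (presented_group X R)" k])
        (use \<open>Q h\<close> \<open>Q k\<close> hk in \<open>simp_all add: Q_def\<close>)
  qed
  ultimately have "Q (presented_hom X R G j)"
    unfolding presented_hom_def Q_def[symmetric] by (rule theI)
  then show "presented_hom X R G j \<in> hom (presented_group X R) G"
    and "x \<in> X \<Longrightarrow> presented_hom X R G j (pres_class X R [(x, True)]) = j x"
    by (auto simp: Q_def)
qed

end

section \<open>Permutations acting on the lattice\<close>

lemma carrier_BijGroup [simp]: "carrier (BijGroup X) = Bij X"
  by (simp add: BijGroup_def)

lemma mult_BijGroup_apply:
  assumes "s \<in> Bij X" "s' \<in> Bij X" "x \<in> X"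
  shows "(s \<otimes>\<^bsub>BijGroup X\<^esub> s') x = s (s' x)"
  using assms by (simp add: BijGroup_def compose_def)

lemma lattice_perm_add:
  assumes "Poly_Mapping.keys a \<subseteq> X" "Poly_Mapping.keys b \<subseteq> X"
  shows "lattice_perm X s (a + b) = lattice_perm X s a + lattice_perm X s b"
proof -
  have "Poly_Mapping.keys (a + b) \<subseteq> X" using assms Poly_Mapping.keys_add[of a b] by blast
  then show ?thesis using assms by (simp add: lattice_perm_def frag_extend_add)
qed

lemma lattice_perm_frag_of [simp]: "x \<in> X \<Longrightarrow> lattice_perm X s (frag_of x) = frag_of (s x)"
  by (simp add: lattice_perm_def)

lemma keys_lattice_perm:
  assumes "s \<in> Bij X" "Poly_Mapping.keys a \<subseteq> X"
  shows "Poly_Mapping.keys (lattice_perm X s a) \<subseteq> X"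
proof -
  have "Poly_Mapping.keys (frag_extend (\<lambda>x. frag_of (s x)) a) \<subseteq> s ` Poly_Mapping.keys a"
    using keys_frag_extend[of "\<lambda>x. frag_of (s x)" a] by auto
  then show ?thesis
    using assms Bij_imp_funcset[OF assms(1)] by (auto simp: lattice_perm_def)
qed

lemma lattice_perm_one:
  assumes "Poly_Mapping.keys a \<subseteq> X"
  shows "lattice_perm X \<one>\<^bsub>BijGroup X\<^esub> a = a"
proof -
  have "frag_extend (\<lambda>x. frag_of (\<one>\<^bsub>BijGroup X\<^esub> x)) a = frag_extend frag_of a"
    using assms by (intro frag_extend_eq) (auto simp: BijGroup_def)
  then show ?thesis using assms frag_expansion[of a] by (simp add: lattice_perm_def)
qed

lemma lattice_perm_mult:
  assumes "s \<in> Bij X" "s' \<in> Bij X" "Poly_Mapping.keys a \<subseteq> X"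
  shows "lattice_perm X (s \<otimes>\<^bsub>BijGroup X\<^esub> s') a = lattice_perm X s (lattice_perm X s' a)"
proof -
  have "frag_extend (\<lambda>x. frag_of ((s \<otimes>\<^bsub>BijGroup X\<^esub> s') x)) a =
      frag_extend ((\<lambda>x. frag_of (s x)) \<circ> s') a"
    using assms by (intro frag_extend_eq) (auto simp: mult_BijGroup_apply)
  also have "\<dots> = frag_extend (\<lambda>x. frag_of (s x)) (frag_extend (frag_of \<circ> s') a)"
    by (simp add: frag_extend_compose)
  finally show ?thesis
    using assms keys_lattice_perm[of s' X a] by (simp add: lattice_perm_def comp_def)
qed

text \<open>The inverse permutation induces the inverse map on the lattice, so functoriality
  (\<open>lattice_perm_mult\<close>) already shows that the induced maps are automorphisms.\<close>

lemma lattice_perm_hom: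
  "lattice_perm X \<in> hom (BijGroup X) (AutoGroup (free_Abelian_group X))"
proof -
  interpret B: group "BijGroup X" by (rule group_BijGroup)
  have Bij: "lattice_perm X s \<in> Bij (carrier (free_Abelian_group X))" if "s \<in> Bij X" for s
  proof -
    have inv: "inv\<^bsub>BijGroup X\<^esub> s \<in> Bij X" using that B.inv_closed by simp
    have "bij_betw (lattice_perm X s) (carrier (free_Abelian_group X))
        (carrier (free_Abelian_group X))"
      using that inv
      by (intro bij_betw_byWitness[where f' = "lattice_perm X (inv\<^bsub>BijGroup X\<^esub> s)"])
        (auto simp: lattice_perm_mult[symmetric] lattice_perm_one
          dest: keys_lattice_perm[THEN subsetD, rotated 2])
    then show ?thesis by (simp add: Bij_def lattice_perm_def)
  qed
  have auto: "lattice_perm X s \<in> auto (free_Abelian_group X)" if "s \<in> Bij X" for s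
    using that Bij keys_lattice_perm[of s X]
    by (auto simp: auto_def hom_def lattice_perm_add simp del: carrier_free_Abelian_group_iff)
       (auto simp: lattice_perm_add)
  have "lattice_perm X (s \<otimes>\<^bsub>BijGroup X\<^esub> s') =
      lattice_perm X s \<otimes>\<^bsub>BijGroup (carrier (free_Abelian_group X))\<^esub> lattice_perm X s'"
    if "s \<in> Bij X" "s' \<in> Bij X" for s s'
  proof (rule extensionalityI[where A = "carrier (free_Abelian_group X)"])
    show "lattice_perm X s \<otimes>\<^bsub>BijGroup (carrier (free_Abelian_group X))\<^esub> lattice_perm X s'
        \<in> extensional (carrier (free_Abelian_group X))"
      using Bij that by (simp add: BijGroup_def)
  qed (use that Bij in \<open>auto simp: lattice_perm_def[of X "s \<otimes>\<^bsub>BijGroup X\<^esub> s'"]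
        mult_BijGroup_apply lattice_perm_mult[symmetric]\<close>)
  then show ?thesis
    using auto by (auto simp: hom_def AutoGroup_def)
qed

text \<open>The inverse of \<open>s t\<close> is
  \<open>t\<^sup>-\<^sup>1 s\<^sup>-\<^sup>1 = s\<^sup>-\<^sup>1 (s t\<^sup>-\<^sup>1 s\<^sup>-\<^sup>1)\<close>,
  whose lattice component is \<open>- s(t)\<close>.\<close>

lemma group_M_group: "group (M_group X)"
proof -
  interpret B: group "BijGroup X" by (rule group_BijGroup)
  have inv: "inv\<^bsub>BijGroup X\<^esub> s \<in> Bij X" if "s \<in> Bij X" for s
    using that B.inv_closed by simp
  have mult: "s \<otimes>\<^bsub>BijGroup X\<^esub> s' \<in> Bij X" if "s \<in> Bij X" "s' \<in> Bij X" for s s'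
    using that B.m_closed by simp
  have add: "Poly_Mapping.keys (a + b) \<subseteq> X"
    if "Poly_Mapping.keys a \<subseteq> X" "Poly_Mapping.keys b \<subseteq> X" for a b :: "'a \<Rightarrow>\<^sub>0 int"
    using that Poly_Mapping.keys_add[of a b] by blast
  show ?thesis
  proof (rule groupI)
    fix p q assume "p \<in> carrier (M_group X)" "q \<in> carrier (M_group X)"
    then show "p \<otimes>\<^bsub>M_group X\<^esub> q \<in> carrier (M_group X)"
      by (cases p, cases q) (simp add: M_group_def mult inv add keys_lattice_perm)
  next
    show "\<one>\<^bsub>M_group X\<^esub> \<in> carrier (M_group X)"
      using B.one_closed by (simp add: M_group_def)
  next
    fix p q r
    assume "p \<in> carrier (M_group X)" "q \<in> carrier (M_group X)" "r \<in> carrier (M_group X)"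
    then show "p \<otimes>\<^bsub>M_group X\<^esub> q \<otimes>\<^bsub>M_group X\<^esub> r =
        p \<otimes>\<^bsub>M_group X\<^esub> (q \<otimes>\<^bsub>M_group X\<^esub> r)"
      by (cases p, cases q, cases r)
        (simp add: M_group_def B.m_assoc B.inv_mult_group lattice_perm_mult lattice_perm_add
          inv mult keys_lattice_perm add.assoc)
  next
    fix p assume "p \<in> carrier (M_group X)"
    then obtain s a where p: "p = (s, a)" "s \<in> Bij X" "Poly_Mapping.keys a \<subseteq> X"
      by (cases p) (auto simp: M_group_def)
    show "\<one>\<^bsub>M_group X\<^esub> \<otimes>\<^bsub>M_group X\<^esub> p = p"
      using p by (simp add: M_group_def) (simp add: lattice_perm_def)
    have "lattice_perm X (inv\<^bsub>BijGroup X\<^esub> s) (- lattice_perm X s a) + a = 0"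
    proof -
      have "lattice_perm X (inv\<^bsub>BijGroup X\<^esub> s) (lattice_perm X s a) = a"
        using p inv by (simp add: lattice_perm_mult[symmetric] lattice_perm_one)
      moreover have "lattice_perm X (inv\<^bsub>BijGroup X\<^esub> s) (- lattice_perm X s a) =
          - lattice_perm X (inv\<^bsub>BijGroup X\<^esub> s) (lattice_perm X s a)"
        using p keys_lattice_perm[of s X a]
        by (simp add: lattice_perm_def[of X "inv\<^bsub>BijGroup X\<^esub> s"] frag_extend_minus)
      ultimately show ?thesis by simp
    qed
    then have "(inv\<^bsub>BijGroup X\<^esub> s, - lattice_perm X s a) \<otimes>\<^bsub>M_group X\<^esub> p = \<one>\<^bsub>M_group X\<^esub>"
      using p by (simp add: M_group_def)
    moreover have "(inv\<^bsub>BijGroup X\<^esub> s, - lattice_perm X s a) \<in> carrier (M_group X)"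
      using p inv by (simp add: M_group_def keys_lattice_perm)
    ultimately show "\<exists>q\<in>carrier (M_group X). q \<otimes>\<^bsub>M_group X\<^esub> p = \<one>\<^bsub>M_group X\<^esub>"
      by blast
  qed
qed

section \<open>Commuting translations over the lattice\<close>

lemma lookup_sum_list_frag_of:
  "Poly_Mapping.lookup (\<Sum>x\<leftarrow>xs. frag_of x) y = int (count (mset xs) y)"
  by (induction xs) (auto simp: lookup_add)

lemma keys_sum_list_frag_of: "Poly_Mapping.keys (\<Sum>x\<leftarrow>xs. frag_of x) \<subseteq> set xs"
  by (auto simp: in_keys_iff lookup_sum_list_frag_of)

text \<open>The maps \<open>L y\<close> generate an action of \<open>\<int>\<^sup>X\<close> on
  \<open>C\<close>, transitive by the assumption that an invariant set containing \<open>e\<close> is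
  everything, and \<open>p\<close> intertwines it with addition. The action is not constructed: a lattice
  element is written as a difference of two lists of generators, and a list acts by folding, which depends
  only on its multiset because the \<open>L y\<close> commute. Every \<open>g\<close> satisfies
  \<open>L\<^bsub>xs\<^esub> g = L\<^bsub>ys\<^esub> e\<close> for some lists, and then
  \<open>p g = [ys] - [xs]\<close>. If also \<open>L\<^bsub>xs'\<^esub> h = L\<^bsub>ys'\<^esub> e\<close> and
  \<open>p g = p h\<close>, then \<open>ys + xs' = ys' + xs\<close> as multisets, so
  \<open>L\<^bsub>xs + xs'\<^esub>\<close> takes the same value at \<open>g\<close> and \<open>h\<close>, and
  injectivity of the \<open>L y\<close> gives \<open>g = h\<close>.\<close>

lemma bij_betw_lattice_if_commuting_translations:
  fixes p :: "'g \<Rightarrow> 'a \<Rightarrow>\<^sub>0 int" and L :: "'a \<Rightarrow> 'g \<Rightarrow> 'g"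
  assumes e: "e \<in> C" "p e = 0"
    and bij: "\<And>y. y \<in> X \<Longrightarrow> bij_betw (L y) C C"
    and comm: "\<And>y z g. y \<in> X \<Longrightarrow> z \<in> X \<Longrightarrow> g \<in> C \<Longrightarrow> L y (L z g) = L z (L y g)"
    and shift: "\<And>y g. y \<in> X \<Longrightarrow> g \<in> C \<Longrightarrow> p (L y g) = p g + frag_of y"
    and connected: "\<And>D. e \<in> D \<Longrightarrow>
      (\<And>y g. y \<in> X \<Longrightarrow> g \<in> C \<Longrightarrow> L y g \<in> D \<longleftrightarrow> g \<in> D) \<Longrightarrow> C \<subseteq> D"
  shows "bij_betw p C (carrier (free_Abelian_group X))"
proof -
  have L_in: "L y g \<in> C" if "y \<in> X" "g \<in> C" for y g
    using bij[OF that(1)] that(2) by (auto simp: bij_betw_def)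
  have fold_in: "fold L xs g \<in> C" if "set xs \<subseteq> X" "g \<in> C" for xs g
    using that by (induction xs arbitrary: g) (auto simp: L_in)
  have fold_mset: "fold L xs g = fold L ys g"
    if eq: "mset xs = mset ys" and xs: "set xs \<subseteq> X" and g: "g \<in> C" for xs ys g
  proof (rule fold_permuted_eq[where P = "\<lambda>g. g \<in> C", OF eq g])
    show "L x z \<in> C" if "x \<in> set xs" "z \<in> C" for x z
      using that xs L_in by blast
    show "L x (L y z) = L y (L x z)" if "x \<in> set xs" "y \<in> set xs" "z \<in> C" for x y z
      using that xs comm by blast
  qed
  have fold_inj: "g = h" if "fold L xs g = fold L xs h" "set xs \<subseteq> X" "g \<in> C" "h \<in> C" for xs g h
    using that
  proof (induction xs arbitrary: g h)
    case (Cons y xs)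
    have "L y g = L y h"
      by (rule Cons.IH) (use Cons.prems L_in in auto)
    then show ?case
      using bij_betw_imp_inj_on[OF bij[of y]] Cons.prems by (auto dest: inj_onD)
  qed simp
  have fold_shift: "p (fold L xs g) = p g + (\<Sum>x\<leftarrow>xs. frag_of x)" if "set xs \<subseteq> X" "g \<in> C" for xs g
    using that by (induction xs arbitrary: g) (auto simp: L_in shift)
  (* The elements that some list of translations moves into the forward orbit of e. *)
  define D where "D = {g \<in> C. \<exists>xs ys. set xs \<subseteq> X \<and> set ys \<subseteq> X \<and> fold L xs g = fold L ys e}"
  have "C \<subseteq> D"
  proof (rule connected)
    show "e \<in> D" using e(1) by (auto simp: D_def intro!: exI[of _ "[]"])
    fix y g assume y: "y \<in> X" and g: "g \<in> C"
    show "L y g \<in> D \<longleftrightarrow> g \<in> D"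
    proof
      assume "L y g \<in> D"
      then obtain xs ys where "set xs \<subseteq> X" "set ys \<subseteq> X" "fold L xs (L y g) = fold L ys e"
        by (auto simp: D_def)
      then have "set (y # xs) \<subseteq> X" "set ys \<subseteq> X" "fold L (y # xs) g = fold L ys e"
        using y by auto
      then show "g \<in> D" using g unfolding D_def by blast
    next
      assume "g \<in> D"
      then obtain xs ys where *: "set xs \<subseteq> X" "set ys \<subseteq> X" "fold L xs g = fold L ys e"
        by (auto simp: D_def)
      have "fold L (y # xs) g = fold L (xs @ [y]) g"
        using * y g by (intro fold_mset) auto
      then have "fold L xs (L y g) = fold L (ys @ [y]) e" using * by simp
      moreover have "set (ys @ [y]) \<subseteq> X" using * y by simp
      ultimately show "L y g \<in> D" using * L_in[OF y g] unfolding D_def by blast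
    qed
  qed
  have "\<exists>xs ys. set xs \<subseteq> X \<and> set ys \<subseteq> X \<and> fold L xs g = fold L ys e \<and>
      p g = (\<Sum>y\<leftarrow>ys. frag_of y) - (\<Sum>x\<leftarrow>xs. frag_of x)" if g: "g \<in> C" for g
  proof -
    obtain xs ys where *: "set xs \<subseteq> X" "set ys \<subseteq> X" "fold L xs g = fold L ys e"
      using \<open>C \<subseteq> D\<close> g by (auto simp: D_def)
    have "p g + (\<Sum>x\<leftarrow>xs. frag_of x) = (\<Sum>y\<leftarrow>ys. frag_of y)"
      using fold_shift[OF *(1) g] fold_shift[OF *(2) e(1)] * e(2) by simp
    then show ?thesis using * by (metis add_diff_cancel)
  qed
  then obtain neg pos where np: "\<And>g. g \<in> C \<Longrightarrow> set (neg g) \<subseteq> X" "\<And>g. g \<in> C \<Longrightarrow> set (pos g) \<subseteq> X"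
    "\<And>g. g \<in> C \<Longrightarrow> fold L (neg g) g = fold L (pos g) e"
    "\<And>g. g \<in> C \<Longrightarrow> p g = (\<Sum>y\<leftarrow>pos g. frag_of y) - (\<Sum>x\<leftarrow>neg g. frag_of x)"
    by metis
  have "inj_on p C"
  proof (rule inj_onI)
    fix g h assume g: "g \<in> C" and h: "h \<in> C" and eq: "p g = p h"
    have "(\<Sum>x\<leftarrow>pos g @ neg h. frag_of x) = (\<Sum>x\<leftarrow>pos h @ neg g. frag_of x)"
      using eq np(4)[OF g] np(4)[OF h] by (simp add: algebra_simps)
    then have "mset (pos g @ neg h) = mset (pos h @ neg g)"
      by (intro multiset_eqI) (metis lookup_sum_list_frag_of of_nat_eq_iff)
    then have "fold L (pos g @ neg h) e = fold L (pos h @ neg g) e"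
      using np g h e(1) by (intro fold_mset) auto
    then have "fold L (neg g @ neg h) g = fold L (neg h @ neg g) h"
      using np(3)[OF g] np(3)[OF h] by simp
    also have "\<dots> = fold L (neg g @ neg h) h"
      using np g h by (intro fold_mset) auto
    finally show "g = h" using np g h
      by (intro fold_inj[of "neg g @ neg h" g h]) simp_all
  qed
  moreover have "p ` C = carrier (free_Abelian_group X)"
  proof (intro equalityI subsetI)
    fix c assume "c \<in> p ` C"
    then obtain g where g: "g \<in> C" "c = p g" by blast
    have "Poly_Mapping.keys c \<subseteq> Poly_Mapping.keys (\<Sum>x\<leftarrow>pos g. frag_of x) \<union>
        Poly_Mapping.keys (\<Sum>x\<leftarrow>neg g. frag_of x)"
      unfolding g(2) np(4)[OF g(1)] by (rule keys_diff)
    also have "\<dots> \<subseteq> set (pos g) \<union> set (neg g)"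
      using keys_sum_list_frag_of by (intro Un_mono)
    also have "\<dots> \<subseteq> X"
      using np(1,2)[OF g(1)] by blast
    finally show "c \<in> carrier (free_Abelian_group X)" by simp
  next
    fix c assume "c \<in> carrier (free_Abelian_group X)"
    then have "Poly_Mapping.keys c \<subseteq> X" by simp
    (* Induction over the lattice proceeds by differences, so the range of p has to be shown closed
       under adding and under subtracting c at the same time. *)
    then have "\<forall>g\<in>C. (\<exists>h\<in>C. p h = p g + c) \<and> (\<exists>h\<in>C. p h = p g - c)"
    proof (induction rule: frag_induction)
      case zero
      show ?case by auto
    next
      case (diff a b)
      show ?case
      proof
        fix g assume "g \<in> C"
        obtain h where h: "h \<in> C" "p h = p g + a" using diff \<open>g \<in> C\<close> by blast
        obtain h' where h': "h' \<in> C" "p h' = p h - b" using diff h by blast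
        obtain k where k: "k \<in> C" "p k = p g - a" using diff \<open>g \<in> C\<close> by blast
        obtain k' where k': "k' \<in> C" "p k' = p k + b" using diff k by blast
        have "p h' = p g + (a - b)" "p k' = p g - (a - b)"
          using h h' k k' by simp_all
        then show "(\<exists>h\<in>C. p h = p g + (a - b)) \<and> (\<exists>h\<in>C. p h = p g - (a - b))"
          using h' k' by blast
      qed
    next
      case (one y)
      show ?case
      proof
        fix g assume g: "g \<in> C"
        obtain h where h: "h \<in> C" "L y h = g"
          using bij_betw_imp_surj_on[OF bij[OF one]] g by (metis imageE)
        then have "p h = p g - frag_of y" using shift[OF one, of h] by simp
        then show "(\<exists>h\<in>C. p h = p g + frag_of y) \<and> (\<exists>h\<in>C. p h = p g - frag_of y)"
          using h g shift[OF one g] L_in[OF one g] by blast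
      qed
    qed
    then obtain h where "h \<in> C" "p h = p e + c" using e(1) by blast
    then show "c \<in> p ` C" using e(2) by auto
  qed
  ultimately show ?thesis by (simp add: bij_betw_def)
qed

section \<open>Nondegenerate symmetric sets\<close>

text \<open>In this locale \<open>\<rho> x\<close> is \<open>f\<^sub>x\<^sup>-\<^sup>1\<close>, and
  \<open>\<sigma> a\<close> is the permutation of \<open>X\<close> by which the group element \<open>a\<close>
  acts.\<close>

locale nondegenerate_symmetric_set =
  fixes X :: "'a set" and S :: "'a \<times> 'a \<Rightarrow> 'a \<times> 'a"
  assumes symmetric: "symmetric_set X S" and nondegenerate: "nondegenerate X S"
begin

abbreviation "f \<equiv> f_map S"
abbreviation "g \<equiv> g_map S"
abbreviation "\<rho> \<equiv> f_inv X S"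
abbreviation "G \<equiv> structure_group X S"
abbreviation "\<sigma> \<equiv> structure_action X S"
abbreviation "\<pi> \<equiv> pi_map X S"
abbreviation "gen x \<equiv> pres_class X (structure_rels X S) [(x, True)]"

lemma S_eq: "S (x, y) = (g x y, f y x)"
  by (simp add: f_map_def g_map_def)

lemma f_bij: "x \<in> X \<Longrightarrow> bij_betw (f x) X X"
  and g_bij: "x \<in> X \<Longrightarrow> bij_betw (g x) X X"
  using nondegenerate by (auto simp: nondegenerate_def)

lemma f_closed [simp]: "x \<in> X \<Longrightarrow> y \<in> X \<Longrightarrow> f x y \<in> X"
  and g_closed [simp]: "x \<in> X \<Longrightarrow> y \<in> X \<Longrightarrow> g x y \<in> X"
  using bij_betwE[OF f_bij] bij_betwE[OF g_bij] by blast+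

lemma involution:
  assumes "x \<in> X" "y \<in> X"
  shows "g (g x y) (f y x) = x" and "f (f y x) (g x y) = y"
proof -
  have "S (S (x, y)) = (x, y)"
    using symmetric assms by (simp add: symmetric_set_def involutive_def)
  then show "g (g x y) (f y x) = x" "f (f y x) (g x y) = y"
    by (simp_all add: S_eq)
qed

text \<open>Compare the third components of the two sides of the braid relation.\<close>

lemma f_braid:
  assumes "x \<in> X" "y \<in> X" "z \<in> X"
  shows "f z (f y x) = f (f z y) (f (g y z) x)"
proof -
  have "S12 S (S23 S (S12 S (x, y, z))) = S23 S (S12 S (S23 S (x, y, z)))"
    using symmetric assms by (auto simp: symmetric_set_def braided_def)
  then show ?thesis by (simp add: S12_def S23_def S_eq)
qed

lemma f_inv_Bij [simp]: "x \<in> X \<Longrightarrow> \<rho> x \<in> Bij X"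
  using f_bij[of x] by (simp add: f_inv_def Bij_def bij_betw_inv_into)

lemma f_inv_closed [simp]: "x \<in> X \<Longrightarrow> y \<in> X \<Longrightarrow> \<rho> x y \<in> X"
  using Bij_imp_funcset[OF f_inv_Bij] by auto

lemma f_f_inv [simp]: "x \<in> X \<Longrightarrow> y \<in> X \<Longrightarrow> f x (\<rho> x y) = y"
  and f_inv_f [simp]: "x \<in> X \<Longrightarrow> y \<in> X \<Longrightarrow> \<rho> x (f x y) = y"
  using f_bij[of x] by (simp_all add: f_inv_def bij_betw_inv_into_right bij_betw_inv_into_left)

text \<open>The inverse of \<open>f_braid\<close>: the assignment \<open>x \<mapsto> \<rho> x\<close> respects
  the defining relations of the structure group.\<close>

lemma f_inv_braid:
  assumes "y \<in> X" "z \<in> X"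
  shows "\<rho> y \<otimes>\<^bsub>BijGroup X\<^esub> \<rho> z = \<rho> (g y z) \<otimes>\<^bsub>BijGroup X\<^esub> \<rho> (f z y)"
proof -
  interpret B: group "BijGroup X" by (rule group_BijGroup)
  show ?thesis
  proof (rule extensionalityI[of _ X])
    have "\<rho> y \<otimes>\<^bsub>BijGroup X\<^esub> \<rho> z \<in> Bij X" "\<rho> (g y z) \<otimes>\<^bsub>BijGroup X\<^esub> \<rho> (f z y) \<in> Bij X"
      using assms B.m_closed by simp_all
    then show "\<rho> y \<otimes>\<^bsub>BijGroup X\<^esub> \<rho> z \<in> extensional X"
      "\<rho> (g y z) \<otimes>\<^bsub>BijGroup X\<^esub> \<rho> (f z y) \<in> extensional X"
      by (simp_all add: Bij_imp_extensional)
  next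
    fix a assume a: "a \<in> X"
    (* Both sides at a are the unique b with f z (f y b) = a. *)
    define b where "b = \<rho> (g y z) (\<rho> (f z y) a)"
    have b: "b \<in> X" using assms a by (simp add: b_def)
    have "f z (f y b) = a"
      using assms a by (simp add: f_braid[OF b assms]) (simp add: b_def)
    then have "\<rho> y (\<rho> z a) = b"
      using assms b by (metis f_closed f_inv_f)
    then show "(\<rho> y \<otimes>\<^bsub>BijGroup X\<^esub> \<rho> z) a = (\<rho> (g y z) \<otimes>\<^bsub>BijGroup X\<^esub> \<rho> (f z y)) a"
      using assms a by (simp add: mult_BijGroup_apply b_def)
  qed
qed

subsection \<open>The structure group and its actions\<close>

lemma group_G: "group G"
  by (simp add: structure_group_def group_presented_group)

lemma gen_closed [simp]: "x \<in> X \<Longrightarrow> gen x \<in> carrier G"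
  by (simp add: structure_group_def)

lemma gen_relation:
  assumes "x \<in> X" "y \<in> X"
  shows "gen x \<otimes>\<^bsub>G\<^esub> gen y = gen (g x y) \<otimes>\<^bsub>G\<^esub> gen (f y x)"
proof -
  have "pres_eq X (structure_rels X S) ([] @ [(x, True), (y, True)] @ [])
      ([] @ [(g x y, True), (f y x, True)] @ [])"
    by (rule pres_eq.pres_rel) (use assms in \<open>auto simp: structure_rels_def S_eq\<close>)
  then show ?thesis
    using assms by (simp add: structure_group_def mult_pres_class pres_class_eq_iff)
qed

lemma structure_hom_extends:
  assumes "group H" and j: "j \<in> X \<rightarrow> carrier H"
    and rel: "\<And>x y. x \<in> X \<Longrightarrow> y \<in> X \<Longrightarrow> j x \<otimes>\<^bsub>H\<^esub> j y = j (g x y) \<otimes>\<^bsub>H\<^esub> j (f y x)"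
  shows "presented_hom X (structure_rels X S) H j \<in> hom G H"
    and "x \<in> X \<Longrightarrow> presented_hom X (structure_rels X S) H j (gen x) = j x"
proof -
  interpret H: group H by fact
  have *: "gword_value H j r = gword_value H j s" if "(r, s) \<in> structure_rels X S" for r s
  proof -
    obtain x y where "x \<in> X" "y \<in> X"
      "r = [(x, True), (y, True)]" "s = [(g x y, True), (f y x, True)]"
      using \<open>(r, s) \<in> structure_rels X S\<close> by (auto simp: structure_rels_def S_eq)
    then show ?thesis using rel[of x y] j by (simp add: Pi_iff)
  qed
  show "presented_hom X (structure_rels X S) H j \<in> hom G H"
    unfolding structure_group_def by (rule H.presented_hom_extends(1)[OF j *])
  show "x \<in> X \<Longrightarrow> presented_hom X (structure_rels X S) H j (gen x) = j x"
    by (rule H.presented_hom_extends(2)[OF j *])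
qed

lemma action_hom: "\<sigma> \<in> hom G (BijGroup X)"
  and action_gen [simp]: "x \<in> X \<Longrightarrow> \<sigma> (gen x) = \<rho> x"
proof -
  have closed: "\<rho> \<in> X \<rightarrow> carrier (BijGroup X)" by simp
  note ext = structure_hom_extends[OF group_BijGroup closed f_inv_braid,
      folded structure_action_def]
  show "\<sigma> \<in> hom G (BijGroup X)" by (rule ext(1)) simp_all
  show "\<sigma> (gen x) = \<rho> x" if "x \<in> X" by (rule ext(2)) (use that in simp_all)
qed

text \<open>In the lattice component both sides are \<open>t\<^bsub>f y x\<^esub> + t\<^sub>y\<close>: the
  left one directly, and the right one because \<open>f (f y x)\<close> sends \<open>g x y\<close> back to
  \<open>y\<close> by involutivity.\<close>

lemma phi_relation:
  assumes "x \<in> X" "y \<in> X"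
  shows "(\<rho> x, frag_of x) \<otimes>\<^bsub>M_group X\<^esub> (\<rho> y, frag_of y) =
    (\<rho> (g x y), frag_of (g x y)) \<otimes>\<^bsub>M_group X\<^esub> (\<rho> (f y x), frag_of (f y x))"
proof -
  have inv: "(inv\<^bsub>BijGroup X\<^esub> \<rho> z) a = f z a" if "z \<in> X" "a \<in> X" for z a
  proof -
    have "\<rho> z (f z a) = a" using that by simp
    moreover have "inj_on (\<rho> z) X" using f_inv_Bij[OF that(1)] by (simp add: Bij_def bij_betw_def)
    ultimately have "inv_into X (\<rho> z) a = f z a"
      using that by (metis f_closed inv_into_f_f)
    then show ?thesis using that by (simp add: inv_BijGroup)
  qed
  show ?thesis
    using assms f_inv_braid[OF assms] by (simp add: M_group_def inv involution add.commute)
qed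

lemma phi_hom: "phi X S \<in> hom G (M_group X)"
  and phi_gen: "x \<in> X \<Longrightarrow> phi X S (gen x) = (\<rho> x, frag_of x)"
proof -
  have closed: "(\<lambda>x. (\<rho> x, frag_of x)) \<in> X \<rightarrow> carrier (M_group X)"
    by (simp add: M_group_def)
  note ext = structure_hom_extends[OF group_M_group closed phi_relation, folded phi_def]
  show "phi X S \<in> hom G (M_group X)" by (rule ext(1)) simp_all
  show "phi X S (gen x) = (\<rho> x, frag_of x)" if "x \<in> X" by (rule ext(2)) (use that in simp_all)
qed

text \<open>Projecting \<open>M\<^sub>X\<close> to its permutation part is a homomorphism, so both sides are
  homomorphisms that agree on the generators.\<close>

lemma fst_phi:
  assumes "a \<in> carrier G"
  shows "fst (phi X S a) = \<sigma> a"
proof (rule group.presented_hom_unique[OF group_BijGroup])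
  show "(\<lambda>a. fst (phi X S a)) \<in> hom (presented_group X (structure_rels X S)) (BijGroup X)"
    using phi_hom unfolding structure_group_def[symmetric]
    by (force simp: hom_def M_group_def Pi_iff split: prod.splits)
  show "\<sigma> \<in> hom (presented_group X (structure_rels X S)) (BijGroup X)"
    using action_hom by (simp add: structure_group_def)
  show "a \<in> carrier (presented_group X (structure_rels X S))"
    using assms by (simp add: structure_group_def)
qed (simp add: phi_gen)

lemma pi_closed:
  assumes "a \<in> carrier G"
  shows "Poly_Mapping.keys (\<pi> a) \<subseteq> X"
proof -
  have "phi X S a \<in> carrier (M_group X)" using assms phi_hom by (auto simp: hom_def)
  then show ?thesis by (auto simp: pi_map_def M_group_def)
qed

text \<open>This is the multiplication rule of \<open>M\<^sub>X\<close>; \<open>fst_phi\<close> turns the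
  permutation occurring in it into the action of \<open>b\<^sup>-\<^sup>1\<close>.\<close>

lemma pi_mult:
  assumes "a \<in> carrier G" "b \<in> carrier G"
  shows "\<pi> (a \<otimes>\<^bsub>G\<^esub> b) = lattice_action X S (inv\<^bsub>G\<^esub> b) (\<pi> a) + \<pi> b"
proof -
  interpret \<sigma>: group_hom G "BijGroup X" \<sigma>
    using action_hom group_G group_BijGroup by (simp add: group_hom_def group_hom_axioms_def)
  have "phi X S (a \<otimes>\<^bsub>G\<^esub> b) = (\<sigma> a, \<pi> a) \<otimes>\<^bsub>M_group X\<^esub> (\<sigma> b, \<pi> b)"
    using assms phi_hom fst_phi
    by (simp add: hom_def pi_map_def flip: fst_phi)
  then show ?thesis
    using assms by (simp add: pi_map_def M_group_def lattice_action_def)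
qed

lemma pi_gen: "x \<in> X \<Longrightarrow> \<pi> (gen x) = frag_of x"
  by (simp add: pi_map_def phi_gen)

lemma lattice_action_hom: "lattice_action X S \<in> hom G (AutoGroup (free_Abelian_group X))"
  using hom_compose[OF action_hom lattice_perm_hom]
  by (simp add: lattice_action_def[abs_def] comp_def)

lemma one_cocycle_pi: "one_cocycle G (free_Abelian_group X) (lattice_action X S) \<pi>"
  unfolding one_cocycle_def group_module_def
  using group_G abelian_free_Abelian_group lattice_action_hom pi_closed pi_mult by auto

subsection \<open>The translations of the structure group\<close>

text \<open>The lift of adding \<open>t\<^sub>y\<close> from the lattice to the structure group (see
  \<open>pi_translation\<close>). Left multiplication by \<open>x\<close> changes \<open>\<pi> a\<close> by
  \<open>a\<^sup>-\<^sup>1 t\<^sub>x\<close>; taking \<open>x = a \<cdot> y\<close> makes that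
  \<open>t\<^sub>y\<close>, independently of \<open>a\<close>.\<close>

definition translation :: "'a \<Rightarrow> 'a gword set \<Rightarrow> 'a gword set"
  where "translation y a = gen (\<sigma> a y) \<otimes>\<^bsub>G\<^esub> a"

lemma action_closed [simp]: "a \<in> carrier G \<Longrightarrow> y \<in> X \<Longrightarrow> \<sigma> a y \<in> X"
  using action_hom by (auto simp: hom_def dest!: Bij_imp_funcset)

lemma action_mult:
  "a \<in> carrier G \<Longrightarrow> b \<in> carrier G \<Longrightarrow> y \<in> X \<Longrightarrow> \<sigma> (a \<otimes>\<^bsub>G\<^esub> b) y = \<sigma> a (\<sigma> b y)"
  using action_hom by (auto simp: hom_def mult_BijGroup_apply Pi_iff)

lemma action_one: "y \<in> X \<Longrightarrow> \<sigma> \<one>\<^bsub>G\<^esub> y = y"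
proof -
  have "\<sigma> \<one>\<^bsub>G\<^esub> = \<one>\<^bsub>BijGroup X\<^esub>"
    using hom_one[OF action_hom group_G group_BijGroup] .
  then show "y \<in> X \<Longrightarrow> \<sigma> \<one>\<^bsub>G\<^esub> y = y" by (simp add: BijGroup_def)
qed

lemma action_inv_cancel:
  assumes "a \<in> carrier G" "y \<in> X"
  shows "\<sigma> (inv\<^bsub>G\<^esub> a) (\<sigma> a y) = y" and "\<sigma> a (\<sigma> (inv\<^bsub>G\<^esub> a) y) = y"
proof -
  interpret G: group G by (rule group_G)
  show "\<sigma> (inv\<^bsub>G\<^esub> a) (\<sigma> a y) = y" "\<sigma> a (\<sigma> (inv\<^bsub>G\<^esub> a) y) = y"
    using assms by (simp_all add: action_one flip: action_mult)
qed

lemma translation_closed [simp]: "y \<in> X \<Longrightarrow> a \<in> carrier G \<Longrightarrow> translation y a \<in> carrier G"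
  using group.is_monoid[OF group_G] by (simp add: translation_def monoid.m_closed)

lemma pi_translation:
  assumes y: "y \<in> X" and a: "a \<in> carrier G"
  shows "\<pi> (translation y a) = \<pi> a + frag_of y"
proof -
  have "\<pi> (translation y a) = lattice_action X S (inv\<^bsub>G\<^esub> a) (frag_of (\<sigma> a y)) + \<pi> a"
    using assms by (simp add: translation_def pi_mult pi_gen)
  also have "lattice_action X S (inv\<^bsub>G\<^esub> a) (frag_of (\<sigma> a y)) = frag_of y"
    using assms by (simp add: lattice_action_def action_inv_cancel)
  finally show ?thesis by (simp add: add.commute)
qed

text \<open>With \<open>u = \<rho> x y\<close> one has \<open>S (u, x) = (g u x, y)\<close>, and involutivity
  identifies \<open>g u x\<close> with \<open>\<rho> y x\<close>; so this is the defining relation for the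
  pair \<open>(u, x)\<close>.\<close>

lemma gen_action_commute:
  assumes "x \<in> X" "y \<in> X"
  shows "gen (\<rho> x y) \<otimes>\<^bsub>G\<^esub> gen x = gen (\<rho> y x) \<otimes>\<^bsub>G\<^esub> gen y"
proof -
  define u where "u = \<rho> x y"
  have u: "u \<in> X" "f x u = y" using assms by (simp_all add: u_def)
  have "f y (g u x) = x" using involution(2)[OF u(1) assms(1)] u by simp
  then have "\<rho> y x = g u x" using assms u by (metis f_inv_f g_closed)
  then show ?thesis using gen_relation[OF u(1) assms(1)] u by (simp add: u_def)
qed

text \<open>Both composites multiply \<open>a\<close> from the left by the two sides of
  \<open>gen_action_commute\<close> applied to \<open>a \<cdot> z\<close> and
  \<open>a \<cdot> y\<close>.\<close>

lemma translation_commute: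
  assumes y: "y \<in> X" and z: "z \<in> X" and a: "a \<in> carrier G"
  shows "translation y (translation z a) = translation z (translation y a)"
proof -
  interpret G: group G by (rule group_G)
  have *: "translation y (translation z a) = gen (\<rho> (\<sigma> a z) (\<sigma> a y)) \<otimes>\<^bsub>G\<^esub> gen (\<sigma> a z) \<otimes>\<^bsub>G\<^esub> a"
    if "y \<in> X" "z \<in> X" for y z
    using that a by (simp add: translation_def action_mult G.m_assoc)
  show ?thesis
    using y z a by (simp add: * gen_action_commute[of "\<sigma> a z" "\<sigma> a y"])
qed

text \<open>For \<open>z\<close> and \<open>x\<close> in \<open>X\<close>, the conditions
  \<open>f x z = x\<close> and \<open>g z x = z\<close> are equivalent: each says that \<open>S\<close>
  preserves one component of \<open>(z, x)\<close>, and then involutivity and nondegeneracy force it to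
  preserve the other. As \<open>g z\<close> is bijective, the second one has exactly one solution
  \<open>x\<close>.\<close>

lemma f_diagonal_ex1:
  assumes z: "z \<in> X"
  shows "\<exists>!x. x \<in> X \<and> f x z = x"
proof -
  obtain x where x: "x \<in> X" "g z x = z"
    using g_bij[OF z] z by (metis bij_betw_imp_surj_on imageE)
  have "g z (f x z) = z" using involution(1)[OF z x(1)] x by simp
  then have "f x z = x"
    using g_bij[OF z] x z by (metis bij_betw_inv_into_left f_closed)
  moreover have "g z x' = z" if x': "x' \<in> X" "f x' z = x'" for x'
  proof -
    have "f x' (g z x') = x'" using involution(2)[OF z x'(1)] x' by simp
    then show ?thesis using x' z by (metis f_inv_f g_closed)
  qed
  ultimately show ?thesis
    using g_bij[OF z] x by (metis bij_betw_inv_into_left)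
qed

text \<open>Solving \<open>x a = b\<close> for \<open>a\<close>, where \<open>x = a \<cdot> y\<close>: since
  \<open>x\<^sup>-\<^sup>1\<close> acts as \<open>f x\<close>, substituting
  \<open>a = x\<^sup>-\<^sup>1 b\<close> into \<open>x = a \<cdot> y\<close> leaves the condition
  \<open>f x (b \<cdot> y) = x\<close> on \<open>x\<close> alone.\<close>

lemma translation_eq_iff:
  assumes y: "y \<in> X" and a: "a \<in> carrier G" and b: "b \<in> carrier G"
  shows "translation y a = b \<longleftrightarrow>
    (\<exists>x\<in>X. f x (\<sigma> b y) = x \<and> a = inv\<^bsub>G\<^esub> gen x \<otimes>\<^bsub>G\<^esub> b)"
proof -
  interpret G: group G by (rule group_G)
  have inv_gen: "\<sigma> (inv\<^bsub>G\<^esub> gen x) z = f x z" if "x \<in> X" "z \<in> X" for x z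
  proof -
    have "\<sigma> (inv\<^bsub>G\<^esub> gen x) (\<rho> x (f x z)) = f x z"
      using that action_inv_cancel(1)[of "gen x" "f x z"] by simp
    then show ?thesis using that by simp
  qed
  have eq: "a = inv\<^bsub>G\<^esub> gen x \<otimes>\<^bsub>G\<^esub> b \<longleftrightarrow> gen x \<otimes>\<^bsub>G\<^esub> a = b" if "x \<in> X" for x
    using that a b by (metis G.inv_solve_left gen_closed)
  show ?thesis
  proof
    assume L: "translation y a = b"
    then have *: "a = inv\<^bsub>G\<^esub> gen (\<sigma> a y) \<otimes>\<^bsub>G\<^esub> b"
      using y a by (subst eq) (auto simp: translation_def)
    then have "\<sigma> a y = f (\<sigma> a y) (\<sigma> b y)"
      using y a b inv_gen[of "\<sigma> a y" "\<sigma> b y"] action_mult[of "inv\<^bsub>G\<^esub> gen (\<sigma> a y)" b y] by simp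
    then show "\<exists>x\<in>X. f x (\<sigma> b y) = x \<and> a = inv\<^bsub>G\<^esub> gen x \<otimes>\<^bsub>G\<^esub> b"
      using * y a by (metis action_closed)
  next
    assume "\<exists>x\<in>X. f x (\<sigma> b y) = x \<and> a = inv\<^bsub>G\<^esub> gen x \<otimes>\<^bsub>G\<^esub> b"
    then obtain x where x: "x \<in> X" "f x (\<sigma> b y) = x" "a = inv\<^bsub>G\<^esub> gen x \<otimes>\<^bsub>G\<^esub> b" by blast
    then have "\<sigma> a y = x" using y b by (simp add: action_mult inv_gen)
    then show "translation y a = b" using x eq[OF x(1)] by (simp add: translation_def)
  qed
qed

lemma bij_translation:
  assumes y: "y \<in> X"
  shows "bij_betw (translation y) (carrier G) (carrier G)"
proof -
  interpret G: group G by (rule group_G)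
  have "\<exists>!a. a \<in> carrier G \<and> translation y a = b" if b: "b \<in> carrier G" for b
  proof -
    obtain x where x: "x \<in> X" "f x (\<sigma> b y) = x" and
      uniq: "\<And>x'. x' \<in> X \<Longrightarrow> f x' (\<sigma> b y) = x' \<Longrightarrow> x' = x"
      using f_diagonal_ex1[OF action_closed[OF b y]] by blast
    show ?thesis
    proof (rule ex1I[of _ "inv\<^bsub>G\<^esub> gen x \<otimes>\<^bsub>G\<^esub> b"])
      show "inv\<^bsub>G\<^esub> gen x \<otimes>\<^bsub>G\<^esub> b \<in> carrier G \<and> translation y (inv\<^bsub>G\<^esub> gen x \<otimes>\<^bsub>G\<^esub> b) = b"
        using x b translation_eq_iff[OF y _ b] by auto
      show "a = inv\<^bsub>G\<^esub> gen x \<otimes>\<^bsub>G\<^esub> b" if "a \<in> carrier G \<and> translation y a = b" for a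
        using that translation_eq_iff[OF y _ b] uniq by blast
    qed
  qed
  then show ?thesis
    by (intro bij_betwI') (use translation_closed[OF y] in \<open>blast, blast, metis\<close>)
qed

text \<open>Left multiplication by a generator \<open>x\<close> is, at each single \<open>a\<close>, a
  translation: \<open>x a = L\<^sub>y(a)\<close> for \<open>y = a\<^sup>-\<^sup>1 \<cdot> x\<close>. So a
  translation-invariant set is closed under multiplication by generators and their inverses.\<close>

lemma carrier_subset_if_translation_invariant:
  assumes one: "\<one>\<^bsub>G\<^esub> \<in> D"
    and D: "\<And>y a. y \<in> X \<Longrightarrow> a \<in> carrier G \<Longrightarrow> translation y a \<in> D \<longleftrightarrow> a \<in> D"
  shows "carrier G \<subseteq> D"
proof
  interpret G: group G by (rule group_G)
  have gen: "gen x \<otimes>\<^bsub>G\<^esub> a \<in> D \<longleftrightarrow> a \<in> D" if x: "x \<in> X" and a: "a \<in> carrier G" for x a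
    using D[of "\<sigma> (inv\<^bsub>G\<^esub> a) x" a] x a by (simp add: translation_def action_inv_cancel)
  fix a assume "a \<in> carrier G"
  then have "a \<in> carrier (presented_group X (structure_rels X S))"
    by (simp add: structure_group_def)
  then show "a \<in> D"
  proof (induction rule: presented_group_induct)
    case one
    then show ?case using assms(1) by (simp add: structure_group_def)
  next
    case (generator x a)
    then show ?case using gen[of x a] by (simp add: structure_group_def)
  next
    case (inverse x a)
    then have a: "a \<in> carrier G" by (simp add: structure_group_def)
    then have "gen x \<otimes>\<^bsub>G\<^esub> (inv\<^bsub>G\<^esub> gen x \<otimes>\<^bsub>G\<^esub> a) = a"
      using inverse by (simp flip: G.m_assoc)
    then have "inv\<^bsub>G\<^esub> gen x \<otimes>\<^bsub>G\<^esub> a \<in> D"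
      using gen[of x "inv\<^bsub>G\<^esub> gen x \<otimes>\<^bsub>G\<^esub> a"] inverse a by simp
    then show ?case by (simp add: structure_group_def)
  qed
qed

lemma bij_pi: "bij_betw \<pi> (carrier G) (carrier (free_Abelian_group X))"
proof (rule bij_betw_lattice_if_commuting_translations[where L = translation and e = "\<one>\<^bsub>G\<^esub>"])
  interpret G: group G by (rule group_G)
  show "\<one>\<^bsub>G\<^esub> \<in> carrier G" by simp
  have "phi X S \<one>\<^bsub>G\<^esub> = \<one>\<^bsub>M_group X\<^esub>"
    by (rule hom_one[OF phi_hom group_G group_M_group])
  then show "\<pi> \<one>\<^bsub>G\<^esub> = 0" by (simp add: pi_map_def M_group_def)
  show "carrier G \<subseteq> D"
    if "\<one>\<^bsub>G\<^esub> \<in> D" "\<And>y a. y \<in> X \<Longrightarrow> a \<in> carrier G \<Longrightarrow> translation y a \<in> D \<longleftrightarrow> a \<in> D" for D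
    using that by (rule carrier_subset_if_translation_invariant)
qed (simp_all add: bij_translation translation_commute pi_translation)

end

theorem proposition2p5:
  fixes X :: "'a set" and S :: "'a \<times> 'a \<Rightarrow> 'a \<times> 'a"
  assumes "symmetric_set X S" and "nondegenerate X S"
  shows "one_cocycle (structure_group X S) (free_Abelian_group X) (lattice_action X S) (pi_map X S)
    \<and> bij_betw (pi_map X S) (carrier (structure_group X S)) (carrier (free_Abelian_group X))"
proof -
  interpret nondegenerate_symmetric_set X S
    using assms by unfold_locales
  show ?thesis using one_cocycle_pi bij_pi by blast
qed

end
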